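(* There exists an integer $n_0$ such that for all integers $n\geq n_0$, $\operatorname{inv}(n) \geq n - 2\sqrt{n\log_2 n}$, where $\operatorname{inv}(n)$ denotes the maximum of $\operatorname{inv}(D)$ over all oriented graphs $D$ of order $n$.
   Context: All graphs are finite. An oriented graph is a digraph without loops and with at most one arc between any two vertices. For an oriented graph $D$ and a set $X\subseteq V(D)$, the inversion of $X$ in $D$ consists in reversing the direction of all arcs of $D$ with both end-vertices in $X$. For a finite family $(X_i)_{i\in I}$ of subsets of $V(D)$, $\operatorname{Inv}(D;(X_i)_{i\in I})$ is the oriented graph obtained by inverting the $X_i$ one after another (the order is irrelevant: an arc is reversed if and only if an odd number of the $X_i$ contain both its end-vertices). The family is a decycling family of $D$ if the resulting oriented graph is acyclic (has no directed cycle). The inversion number $\operatorname{inv}(D)$ is the minimum cardinality of a decycling family of $D$. The order of $D$ is its number of vertices. *)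

theory Defs
  imports Complex_Main "Graph_Theory.Graph_Theory"
begin

locale oriented_graph = pair_digraph G for G :: "'a pair_pre_digraph" +
  assumes oriented: "(u, v) \<in> parcs G \<Longrightarrow> (v, u) \<notin> parcs G"

definition invert :: "'a set \<Rightarrow> 'a pair_pre_digraph \<Rightarrow> 'a pair_pre_digraph" where
  "invert X D = \<lparr>pverts = pverts D, parcs = swap_in (X \<times> X) ` parcs D\<rparr>"

text \<open>A finite family of vertex sets is a list of sets, so that members may repeat and the
  cardinality of the family is the length of the list.\<close>

definition invert_family :: "'a pair_pre_digraph \<Rightarrow> 'a set list \<Rightarrow> 'a pair_pre_digraph" where
  "invert_family D Xs = fold invert Xs D"

definition acyclic_digraph :: "'a pair_pre_digraph \<Rightarrow> bool" where
  "acyclic_digraph D \<longleftrightarrow> (\<nexists>p. pre_digraph.cycle (with_proj D) p)"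

definition decycling_family :: "'a pair_pre_digraph \<Rightarrow> 'a set list \<Rightarrow> bool" where
  "decycling_family D Xs \<longleftrightarrow>
     (\<forall>X \<in> set Xs. X \<subseteq> pverts D) \<and> acyclic_digraph (invert_family D Xs)"

definition inversion_number :: "'a pair_pre_digraph \<Rightarrow> nat" where
  "inversion_number D = (LEAST k. \<exists>Xs. decycling_family D Xs \<and> length Xs = k)"

text \<open>Every finite digraph has an isomorphic copy with natural numbers as vertices, so the maximum
  is taken over such digraphs. It exists and also bounds the inversion numbers of oriented graphs
  over any other vertex type: see \<open>max_inversion_number_attained\<close> and
  \<open>inversion_number_le_max\<close> below.\<close>

definition max_inversion_number :: "nat \<Rightarrow> nat" where
  "max_inversion_number n =
     Max {inversion_number D | D :: nat pair_pre_digraph.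
            oriented_graph D \<and> card (pverts D) = n}"

lemma invert_simps [simp]:
  "pverts (invert X D) = pverts D"
  "parcs (invert X D) = swap_in (X \<times> X) ` parcs D"
  by (simp_all add: invert_def)

lemma parcs_invert_iff:
  fixes D :: "'a pair_pre_digraph"
  shows "(u, v) \<in> parcs (invert X D) \<longleftrightarrow>
     (if u \<in> X \<and> v \<in> X then (v, u) \<in> parcs D else (u, v) \<in> parcs D)"
proof -
  have invol: "swap_in (X \<times> X) (swap_in (X \<times> X) e) = e" for e :: "'a \<times> 'a"
    by (cases e) (auto simp: swap_in_def)
  have "(u, v) \<in> parcs (invert X D) \<longleftrightarrow> swap_in (X \<times> X) (u, v) \<in> parcs D"
  proof
    assume "(u, v) \<in> parcs (invert X D)"
    then obtain e where "e \<in> parcs D" "(u, v) = swap_in (X \<times> X) e" by auto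
    then show "swap_in (X \<times> X) (u, v) \<in> parcs D" by (simp only: invol)
  next
    assume "swap_in (X \<times> X) (u, v) \<in> parcs D"
    from imageI[OF this, of "swap_in (X \<times> X)"] show "(u, v) \<in> parcs (invert X D)"
      by (simp only: invol invert_simps)
  qed
  then show ?thesis by (simp add: swap_in_def)
qed

lemma pverts_invert_family [simp]: "pverts (invert_family D Xs) = pverts D"
  unfolding invert_family_def by (induction Xs arbitrary: D) auto

lemma oriented_graph_invert:
  assumes "oriented_graph D" shows "oriented_graph (invert X D)"
proof -
  interpret oriented_graph D by fact
  show ?thesis
  proof
    show "fst e \<in> pverts (invert X D)" "snd e \<in> pverts (invert X D)" "fst e \<noteq> snd e"
      if e: "e \<in> parcs (invert X D)" for e
    proof -
      obtain a where "a \<in> parcs D" "e = swap_in (X \<times> X) a"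
        using e by auto
      then show "fst e \<in> pverts (invert X D)" "snd e \<in> pverts (invert X D)" "fst e \<noteq> snd e"
        using arc_fst_in_verts[of a] arc_snd_in_verts[of a] pair_no_loops[of a]
        by (auto simp: swap_in_def)
    qed
    show "finite (pverts (invert X D))" "finite (parcs (invert X D))"
      using pair_finite_verts pair_finite_arcs by simp_all
    show "\<And>u v. (u, v) \<in> parcs (invert X D) \<Longrightarrow> (v, u) \<notin> parcs (invert X D)"
      using oriented unfolding parcs_invert_iff by (auto split: if_splits)
  qed
qed

lemma acyclic_digraph_increasing:
  fixes f :: "'a \<Rightarrow> nat"
  assumes "\<And>u v. (u, v) \<in> parcs D \<Longrightarrow> f u < f v"
  shows "acyclic_digraph D"
proof -
  have *: "set p \<subseteq> parcs D \<Longrightarrow> pcas u p v \<Longrightarrow> p \<noteq> [] \<Longrightarrow> f u < f v" for p u v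
  proof (induction p arbitrary: u)
    case (Cons e p)
    then have "f u < f (snd e)" using assms[of "fst e" "snd e"] by auto
    then show ?case
      using Cons.IH[of "snd e"] Cons.prems less_trans by (cases "p = []") auto
  qed simp
  show ?thesis
    unfolding acyclic_digraph_def pre_digraph.cycle_def pre_digraph.awalk_def cas_with_proj_eq
      with_proj_simps
    using * less_irrefl by blast
qed

lemma ex_decycling_family:
  assumes "oriented_graph D"
  shows "\<exists>Xs. decycling_family D Xs \<and> length Xs \<le> card (parcs D)"
proof -
  have "finite (pverts D)"
    using assms by (simp add: oriented_graph_def pair_digraph_def pair_fin_digraph.pair_finite_verts)
  then obtain f :: "'a \<Rightarrow> nat" where f: "inj_on f (pverts D)"
    using finite_imp_inj_to_nat_seg[of "pverts D"] by blast
  define B where "B = (\<lambda>D :: 'a pair_pre_digraph. {e \<in> parcs D. f (snd e) < f (fst e)})"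
  have "\<exists>Xs. decycling_family D Xs \<and> length Xs = card (B D)"
    using assms f
  proof (induction "card (B D)" arbitrary: D)
    case 0
    interpret oriented_graph D by fact
    have "B D = {}"
      using 0 pair_finite_arcs by (auto simp: B_def)
    have "f u < f v" if "(u, v) \<in> parcs D" for u v
    proof -
      have "f u \<noteq> f v"
        using pair_no_loops[OF that] in_arcsD1[OF that] in_arcsD2[OF that] inj_onD[OF 0(3)] by auto
      moreover have "\<not> f v < f u"
        using that \<open>B D = {}\<close> by (auto simp: B_def)
      ultimately show ?thesis by simp
    qed
    then have "decycling_family D []"
      by (auto simp: decycling_family_def invert_family_def intro: acyclic_digraph_increasing)
    then show ?case using 0(1) by auto
  next
    case (Suc n)
    interpret oriented_graph D by fact
    from Suc(2) have "B D \<noteq> {}" by auto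
    then obtain u v where uv: "(u, v) \<in> B D" by auto
    then have arc: "(u, v) \<in> parcs D" and less: "f v < f u" by (auto simp: B_def)
    let ?D = "invert {u, v} D"
    have "B ?D = B D - {(u, v)}"
    proof -
      have "(a, b) \<in> B ?D \<longleftrightarrow> (a, b) \<in> B D - {(u, v)}" for a b
        using arc less oriented[OF arc] pair_no_loops
        unfolding B_def mem_Collect_eq Diff_iff parcs_invert_iff by (auto split: if_splits)
      then show ?thesis by auto
    qed
    then have "n = card (B ?D)"
      using uv Suc(2) by simp
    then obtain Xs where Xs: "decycling_family ?D Xs" "length Xs = n"
      using Suc(1)[of ?D] oriented_graph_invert[OF Suc(3)] Suc(4) by auto
    have "decycling_family D ({u, v} # Xs)"
      using Xs in_arcsD1[OF arc] in_arcsD2[OF arc]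
      by (auto simp: decycling_family_def invert_family_def)
    then show ?case using Xs Suc(2) by (metis length_Cons)
  qed
  moreover have "card (B D) \<le> card (parcs D)"
    using assms
    by (intro card_mono)
      (auto simp: B_def oriented_graph_def pair_digraph_def pair_fin_digraph.pair_finite_arcs)
  ultimately show ?thesis by auto
qed

lemma inversion_number_attained:
  assumes "oriented_graph D"
  shows "\<exists>Xs. decycling_family D Xs \<and> length Xs = inversion_number D"
  unfolding inversion_number_def
  by (rule LeastI_ex) (use ex_decycling_family[OF assms] in blast)

lemma inversion_number_le:
  assumes "decycling_family D Xs"
  shows "inversion_number D \<le> length Xs"
  unfolding inversion_number_def using assms by (intro Least_le) blast

lemma inversion_number_bound:
  assumes "oriented_graph D"
  shows "inversion_number D \<le> card (pverts D) * card (pverts D)"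
proof -
  interpret oriented_graph D by fact
  have "card (parcs D) \<le> card (pverts D \<times> pverts D)"
    using pair_finite_verts by (intro card_mono) (auto dest: in_arcsD1 in_arcsD2)
  moreover obtain Xs where "decycling_family D Xs" "length Xs \<le> card (parcs D)"
    using ex_decycling_family[OF assms] by blast
  ultimately show ?thesis
    using inversion_number_le[of D Xs] by (simp add: card_cartesian_product)
qed

lemma finite_inversion_numbers:
  "finite {inversion_number D | D :: nat pair_pre_digraph.
     oriented_graph D \<and> card (pverts D) = n}"
  by (rule finite_subset[of _ "{..n * n}"]) (use inversion_number_bound in auto)

lemma max_inversion_number_attained:
  "\<exists>D :: nat pair_pre_digraph.
     oriented_graph D \<and> card (pverts D) = n \<and> inversion_number D = max_inversion_number n"
proof -
  have "oriented_graph \<lparr>pverts = {..<n}, parcs = {}\<rparr>"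
    by unfold_locales auto
  then have "{inversion_number D | D :: nat pair_pre_digraph.
      oriented_graph D \<and> card (pverts D) = n} \<noteq> {}"
    by (force intro!: exI[of _ "\<lparr>pverts = {..<n}, parcs = {}\<rparr>"])
  from Max_in[OF finite_inversion_numbers this] show ?thesis
    unfolding max_inversion_number_def by auto
qed

lemma inversion_number_le_max:
  fixes D :: "'a pair_pre_digraph"
  assumes "oriented_graph D"
  shows "inversion_number D \<le> max_inversion_number (card (pverts D))"
proof -
  interpret oriented_graph D by fact
  obtain g :: "'a \<Rightarrow> nat" where g: "inj_on g (pverts D)"
    using finite_imp_inj_to_nat_seg[OF pair_finite_verts] by blast
  define h where
    "h = (\<lambda>D :: 'a pair_pre_digraph. \<lparr>pverts = g ` pverts D, parcs = map_prod g g ` parcs D\<rparr>)"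
  have h_simps: "pverts (h E) = g ` pverts E" "parcs (h E) = map_prod g g ` parcs E" for E
    by (simp_all add: h_def)
  have oriented_h: "oriented_graph (h D)"
  proof
    show "\<And>e. e \<in> parcs (h D) \<Longrightarrow> fst e \<in> pverts (h D)"
      "\<And>e. e \<in> parcs (h D) \<Longrightarrow> snd e \<in> pverts (h D)"
      using arc_fst_in_verts arc_snd_in_verts by (force simp: h_simps)+
    show "\<And>e. e \<in> parcs (h D) \<Longrightarrow> fst e \<noteq> snd e"
      using g pair_no_loops in_arcsD1 in_arcsD2 by (fastforce simp: h_simps dest: inj_onD)
    show "finite (pverts (h D))" "finite (parcs (h D))"
      using pair_finite_verts pair_finite_arcs by (simp_all add: h_simps)
    show "(v, u) \<notin> parcs (h D)" if "(u, v) \<in> parcs (h D)" for u v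
    proof
      assume "(v, u) \<in> parcs (h D)"
      with that obtain a b c d where *: "(a, b) \<in> parcs D" "(c, d) \<in> parcs D"
        "g a = u" "g b = v" "g c = v" "g d = u"
        by (auto simp: h_simps)
      then have "c = b" "d = a"
        using inj_onD[OF g] in_arcsD1 in_arcsD2 by metis+
      with * oriented show False by blast
    qed
  qed
  have h_invert: "h (invert {x \<in> pverts D. g x \<in> X} E) = invert X (h E)"
    if "oriented_graph E" "pverts E = pverts D" for E X
  proof -
    interpret E: oriented_graph E by fact
    have "map_prod g g (swap_in ({x \<in> pverts D. g x \<in> X} \<times> {x \<in> pverts D. g x \<in> X}) e)
        = swap_in (X \<times> X) (map_prod g g e)" if "e \<in> parcs E" for e
      using E.arc_fst_in_verts[OF that] E.arc_snd_in_verts[OF that] \<open>pverts E = pverts D\<close>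
      by (cases e) (auto simp: swap_in_def)
    then show ?thesis
      by (simp add: h_def invert_def image_image)
  qed
  have h_family: "oriented_graph E \<Longrightarrow> pverts E = pverts D \<Longrightarrow>
      h (invert_family E (map (\<lambda>X. {x \<in> pverts D. g x \<in> X}) Xs)) = invert_family (h E) Xs
      \<and> oriented_graph (invert_family E (map (\<lambda>X. {x \<in> pverts D. g x \<in> X}) Xs))" for E Xs
    unfolding invert_family_def
    by (induction Xs arbitrary: E) (auto simp: h_invert oriented_graph_invert)
  have acyclic_h: "acyclic_digraph E"
    if "acyclic_digraph (h E)" "oriented_graph E" "pverts E = pverts D" for E
  proof -
    interpret E: oriented_graph E by fact
    have cas: "pcas (g u) (map (map_prod g g) p) (g v)" if "pcas u p v" for u p v
      using that by (induction p arbitrary: u) auto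
    have verts: "pawalk_verts (g u) (map (map_prod g g) p) = map g (pawalk_verts u p)" for u p
      by (induction p arbitrary: u) auto
    have sub: "set (pawalk_verts u p) \<subseteq> pverts D" if "set p \<subseteq> parcs E" "u \<in> pverts D" for u p
      using that E.arc_fst_in_verts E.arc_snd_in_verts \<open>pverts E = pverts D\<close>
      by (induction p arbitrary: u) auto
    have tl_sub: "set (tl xs) \<subseteq> set xs" for xs :: "'a list"
      by (cases xs) auto
    have "pre_digraph.cycle (with_proj (h E)) (map (map_prod g g) p)"
      if cyc: "pre_digraph.cycle (with_proj E) p" for p
    proof -
      obtain u where u: "u \<in> pverts D" "set p \<subseteq> parcs E" "pcas u p u"
        "distinct (tl (pawalk_verts u p))" "p \<noteq> []"
        using cyc \<open>pverts E = pverts D\<close>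
        unfolding pre_digraph.cycle_def pre_digraph.awalk_def cas_with_proj_eq
          awalk_verts_with_proj_eq with_proj_simps by auto
      have "set (tl (pawalk_verts u p)) \<subseteq> pverts D"
        using order_trans[OF tl_sub sub[OF u(2,1)]] .
      then have "distinct (tl (pawalk_verts (g u) (map (map_prod g g) p)))"
        unfolding verts map_tl[symmetric] distinct_map
        using u(4) inj_on_subset[OF g] by simp
      moreover have "set (map (map_prod g g) p) \<subseteq> parcs (h E)" "g u \<in> pverts (h E)"
        using u \<open>pverts E = pverts D\<close> by (auto simp: h_simps)
      ultimately show ?thesis
        unfolding pre_digraph.cycle_def pre_digraph.awalk_def cas_with_proj_eq
          awalk_verts_with_proj_eq with_proj_simps
        using cas[OF u(3)] u(5) by blast
    qed
    with that(1) show ?thesis unfolding acyclic_digraph_def by blast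
  qed
  obtain Xs where Xs: "decycling_family (h D) Xs" "length Xs = inversion_number (h D)"
    using inversion_number_attained[OF oriented_h] by blast
  have "decycling_family D (map (\<lambda>X. {x \<in> pverts D. g x \<in> X}) Xs)"
    using Xs(1) h_family[OF assms refl, of Xs] acyclic_h
    unfolding decycling_family_def by auto
  from inversion_number_le[OF this] have "inversion_number D \<le> inversion_number (h D)"
    using Xs(2) by simp
  also have "\<dots> \<le> max_inversion_number (card (pverts D))"
    unfolding max_inversion_number_def
    using oriented_h card_image[OF g]
    by (intro Max_ge finite_inversion_numbers) (auto simp: h_simps)
  finally show ?thesis .
qed

end

theory Submission
  imports Defs "HOL-Library.Z2" "HOL-Library.FuncSet"
begin

text \<open>Invert a tournament on \<open>n\<close> vertices by \<open>k\<close> sets \<open>X\<^sub>t\<close>, and let \<open>x\<^sub>i\<close> be the vector over the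
  two-element field with \<open>x\<^sub>i(t) = 1\<close> iff \<open>i \<in> X\<^sub>t\<close>. The arc between \<open>i\<close> and \<open>j\<close> is reversed
  iff the scalar product of \<open>x\<^sub>i\<close> and \<open>x\<^sub>j\<close> is 1. If the result is acyclic, it is a linear order, so the
  tournament is determined by this order and the Gram matrix of the \<open>x\<^sub>i\<close>. The \<open>x\<^sub>i\<close> are spanned by
  \<open>k\<close> of them, indexed by \<open>I\<close> say, so the Gram matrix is determined by \<open>I\<close>, its block on \<open>I\<close> and
  \<open>n - k\<close> coefficient vectors of length \<open>k\<close>. If all tournaments arise in this way, then
  \<open>2\<^bsup>n(n-1)/2\<^esup> \<le> n\<^sup>n 2\<^sup>n 2\<^bsup>k(k+1)/2\<^esup> 2\<^bsup>k(n-k)\<^esup>\<close>, and taking logarithms bounds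
  \<open>(n - k)\<^sup>2\<close> by \<open>2 n log\<^sub>2 n + 4 n\<close>.\<close>

section \<open>Spanning families over the two-element field\<close>

lemma UNIV_bit: "(UNIV :: bit set) = {0, 1}"
  using bit.exhaust by blast

text \<open>A maximal independent set \<open>J\<close> spans, and has at most \<open>m\<close>
  elements because the vectors have \<open>m\<close> coordinates. It is enlarged to exactly
  \<open>k\<close> elements so that later counts depend on \<open>k\<close> alone.\<close>

lemma ex_spanning_subset:
  fixes x :: "'a \<Rightarrow> nat \<Rightarrow> bit"
  assumes "finite V" "m \<le> k" "k \<le> card V"
  obtains I where "I \<subseteq> V" "card I = k"
    "\<And>j. j \<in> V \<Longrightarrow> \<exists>C\<subseteq>I. \<forall>t<m. x j t = (\<Sum>i\<in>C. x i t)"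
proof -
  define \<sigma> where "\<sigma> = (\<lambda>C. restrict (\<lambda>t. \<Sum>i\<in>C. x i t) {..<m})"
  \<comment> \<open>Coefficients are 0 or 1, so linear combinations are subset sums, and
    independence means that distinct subsets have distinct sums.\<close>
  define ind where "ind = (\<lambda>J. J \<subseteq> V \<and> inj_on \<sigma> (Pow J))"
  have "ind {}" by (simp add: ind_def)
  moreover have "card J \<le> card V" if "ind J" for J
    using that assms(1) by (auto simp: ind_def intro: card_mono)
  ultimately have "\<exists>J. ind J \<and> (\<forall>K. ind K \<longrightarrow> card K \<le> card J)"
    by (intro ex_has_greatest_nat[of ind "{}" card "Suc (card V)"]) (simp_all add: less_Suc_eq_le)
  then obtain J where J: "ind J" and max: "\<And>K. ind K \<Longrightarrow> card K \<le> card J"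
    by blast
  have fin: "finite C" if "C \<subseteq> J" for C
    using that J assms(1) by (meson finite_subset ind_def)
  \<comment> \<open>The \<open>2^|J|\<close> distinct sums lie in a space of \<open>2^m\<close>
    vectors.\<close>
  have "card (Pow J) \<le> card ({..<m} \<rightarrow>\<^sub>E (UNIV :: bit set))"
  proof (rule card_inj_on_le)
    show "inj_on \<sigma> (Pow J)" using J by (simp add: ind_def)
    show "\<sigma> ` Pow J \<subseteq> {..<m} \<rightarrow>\<^sub>E UNIV"
      unfolding \<sigma>_def by (intro image_subsetI restrict_PiE_iff[THEN iffD2]) simp
    show "finite ({..<m} \<rightarrow>\<^sub>E (UNIV :: bit set))"
      by (intro finite_PiE) (simp_all add: UNIV_bit)
  qed
  also have "\<dots> = 2 ^ m"
    by (simp add: card_PiE UNIV_bit numeral_2_eq_2)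
  finally have "card J \<le> m"
    using fin[of J] by (simp add: card_Pow)
  have "J \<subseteq> V" using J by (simp add: ind_def)
  have span: "\<exists>C\<subseteq>J. \<forall>t<m. x j t = (\<Sum>i\<in>C. x i t)" if "j \<in> V" for j
  proof (cases "j \<in> J")
    case True
    then show ?thesis by (intro exI[of _ "{j}"]) auto
  next
    case False
    \<comment> \<open>By maximality of \<open>J\<close>, two distinct subsets of
      \<open>insert j J\<close> have equal sums. Exactly one of them contains \<open>j\<close>, so
      the relation can be solved for \<open>x j\<close>.\<close>
    have "\<not> ind (insert j J)"
      using max[of "insert j J"] False fin[of J] by auto
    then have "\<not> inj_on \<sigma> (Pow (insert j J))"
      using \<open>J \<subseteq> V\<close> that by (auto simp: ind_def)
    then obtain A B where AB: "A \<subseteq> insert j J" "B \<subseteq> insert j J" "A \<noteq> B" "\<sigma> A = \<sigma> B"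
      by (auto simp: inj_on_def)
    define S where "S = (\<lambda>C t. \<Sum>i\<in>C. x i t)"
    have S_eq: "S A t = S B t" if "t < m" for t
      using fun_cong[OF AB(4), of t] that by (simp add: \<sigma>_def S_def)
    have split: "S C t = (if j \<in> C then x j t else 0) + S (C - {j}) t"
      if "C \<subseteq> insert j J" for C t
      using finite_subset[OF that] fin[of J] by (auto simp: S_def sum.remove)
    let ?A = "A - {j}" and ?B = "B - {j}"
    have sub: "?A \<subseteq> J" "?B \<subseteq> J" using AB by auto
    have "(j \<in> A) \<noteq> (j \<in> B)"
    proof
      assume same: "(j \<in> A) = (j \<in> B)"
      have "S ?A t = S ?B t" if "t < m" for t
      proof -
        have "(if j \<in> B then x j t else 0) + S ?A t = (if j \<in> B then x j t else 0) + S ?B t"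
          using S_eq[OF that] split[OF AB(1), of t] split[OF AB(2), of t] same by metis
        then show ?thesis by (rule add_left_imp_eq)
      qed
      then have "\<sigma> ?A = \<sigma> ?B"
        by (auto simp: \<sigma>_def S_def restrict_def)
      then have "?A = ?B"
        using J sub by (auto simp: ind_def inj_on_def)
      with same AB(3) show False by blast
    qed
    then have x_eq: "x j t = S ?A t + S ?B t" if "t < m" for t
      using S_eq[OF that] split[OF AB(1), of t] split[OF AB(2), of t]
      by (cases "x j t"; cases "S ?A t"; cases "S ?B t") (auto split: if_splits)
    \<comment> \<open>In characteristic 2 the common part cancels, leaving the symmetric
      difference.\<close>
    have "S ?A t + S ?B t = S (?A - ?B \<union> (?B - ?A)) t" for t
    proof -
      have "S ?A t = S (?A - ?B) t + S (?A \<inter> ?B) t" "S ?B t = S (?B - ?A) t + S (?A \<inter> ?B) t"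
        unfolding S_def using fin sub
        by (metis sum.Int_Diff add.commute, metis sum.Int_Diff add.commute Int_commute)
      moreover have "S (?A - ?B \<union> (?B - ?A)) t = S (?A - ?B) t + S (?B - ?A) t"
        unfolding S_def using fin sub by (intro sum.union_disjoint) auto
      ultimately show ?thesis
        by (cases "S (?A \<inter> ?B) t") (auto simp: algebra_simps)
    qed
    with x_eq have "\<forall>t<m. x j t = (\<Sum>i\<in>?A - ?B \<union> (?B - ?A). x i t)"
      unfolding S_def by simp
    then show ?thesis using sub by (intro exI[of _ "?A - ?B \<union> (?B - ?A)"]) auto
  qed
  obtain I where I: "J \<subseteq> I" "I \<subseteq> V" "card I = k"
    using exists_subset_between[of J k V] \<open>J \<subseteq> V\<close> \<open>card J \<le> m\<close> assms by auto
  show thesis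
    using that[OF I(2,3)] span I(1) by (meson subset_trans)
qed

section \<open>Pairs in a linearly ordered set\<close>

text \<open>The square splits into the pairs above the diagonal, their mirror images and the
  diagonal.\<close>

lemma card_less_pairs:
  fixes I :: "'a :: linorder set"
  assumes "finite I"
  shows "2 * card {(a, b). a \<in> I \<and> b \<in> I \<and> a < b} + card I = card I * card I"
proof -
  let ?L = "{(a, b). a \<in> I \<and> b \<in> I \<and> a < b}"
  have fin: "finite ?L" by (rule finite_subset[of _ "I \<times> I"]) (use assms in auto)
  have "I \<times> I = ?L \<union> prod.swap ` ?L \<union> (\<lambda>a. (a, a)) ` I" by (auto simp: image_iff)
  then have "card (I \<times> I) = card (?L \<union> prod.swap ` ?L \<union> (\<lambda>a. (a, a)) ` I)" by simp
  also have "\<dots> = card (?L \<union> prod.swap ` ?L) + card ((\<lambda>a. (a, a)) ` I)"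
    using fin assms by (intro card_Un_disjoint) auto
  also have "card (?L \<union> prod.swap ` ?L) = card ?L + card (prod.swap ` ?L)"
    using fin by (intro card_Un_disjoint) auto
  finally show ?thesis
    by (simp add: card_image inj_on_def card_cartesian_product)
qed

lemma card_le_pairs:
  fixes I :: "'a :: linorder set"
  assumes "finite I"
  shows "2 * card {(a, b). a \<in> I \<and> b \<in> I \<and> a \<le> b} = card I * card I + card I"
proof -
  let ?L = "{(a, b). a \<in> I \<and> b \<in> I \<and> a < b}"
  have fin: "finite ?L" by (rule finite_subset[of _ "I \<times> I"]) (use assms in auto)
  have "{(a, b). a \<in> I \<and> b \<in> I \<and> a \<le> b} = ?L \<union> (\<lambda>a. (a, a)) ` I" by auto
  also have "card \<dots> = card ?L + card I"
    using fin assms by (subst card_Un_disjoint) (auto simp: card_image inj_on_def)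
  finally show ?thesis using card_less_pairs[OF assms] by simp
qed

section \<open>Inversions and the Gram matrix\<close>

text \<open>The scalar product of the incidence vectors of \<open>u\<close> and \<open>v\<close>;
  summing over the list counts repeated sets with multiplicity.\<close>

definition common :: "'a set list \<Rightarrow> 'a \<Rightarrow> 'a \<Rightarrow> bit" where
  "common Xs u v = (\<Sum>X\<leftarrow>Xs. of_bool (u \<in> X \<and> v \<in> X))"

lemma common_commute: "common Xs u v = common Xs v u"
  by (simp add: common_def conj_commute)

text \<open>Each set containing both ends exchanges the two directions, so only the parity of the
  number of such sets matters.\<close>

lemma parcs_invert_family_iff:
  "(u, v) \<in> parcs (invert_family D Xs) \<longleftrightarrow>
     (if common Xs u v = 1 then (v, u) \<in> parcs D else (u, v) \<in> parcs D)"
proof (induction Xs arbitrary: D)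
  case (Cons X Xs)
  show ?case
    using Cons.IH[of "invert X D"] common_commute[of Xs u v]
    by (cases "common Xs u v")
       (auto simp: invert_family_def common_def parcs_invert_iff simp del: invert_simps)
qed (simp add: invert_family_def common_def)

lemma oriented_graph_invert_family:
  "oriented_graph D \<Longrightarrow> oriented_graph (invert_family D Xs)"
  unfolding invert_family_def
  by (induction Xs arbitrary: D) (auto simp: oriented_graph_invert)

section \<open>Acyclic tournaments are linear orders\<close>

lemma acyclic_digraph_no_triangle:
  assumes "oriented_graph D" "acyclic_digraph D" "(a, b) \<in> parcs D" "(b, c) \<in> parcs D"
  shows "(c, a) \<notin> parcs D"
proof
  assume "(c, a) \<in> parcs D"
  interpret oriented_graph D by fact
  have "pre_digraph.cycle (with_proj D) [(a, b), (b, c), (c, a)]"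
    unfolding pre_digraph.cycle_def pre_digraph.awalk_def cas_with_proj_eq
      awalk_verts_with_proj_eq with_proj_simps
    using assms \<open>(c, a) \<in> parcs D\<close> in_arcsD1[OF assms(3)]
      pair_no_loops[OF assms(3)] pair_no_loops[OF assms(4)] pair_no_loops[OF \<open>(c, a) \<in> parcs D\<close>]
    by (intro exI[of _ a]) auto
  then show False using assms(2) by (auto simp: acyclic_digraph_def)
qed

text \<open>The rank of a vertex is its in-degree.\<close>

lemma acyclic_tournament_rank:
  assumes "oriented_graph D" "acyclic_digraph D"
    and total: "\<And>u v. u \<in> pverts D \<Longrightarrow> v \<in> pverts D \<Longrightarrow> u \<noteq> v \<Longrightarrow>
      (u, v) \<in> parcs D \<or> (v, u) \<in> parcs D"
  obtains f where "f \<in> pverts D \<rightarrow> {..<card (pverts D)}"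
    "\<And>u v. u \<in> pverts D \<Longrightarrow> v \<in> pverts D \<Longrightarrow> (u, v) \<in> parcs D \<longleftrightarrow> f u < f v"
proof -
  interpret oriented_graph D by fact
  define N where "N = (\<lambda>v. {w. (w, v) \<in> parcs D})"
  have sub: "N v \<subseteq> pverts D" "v \<notin> N v" for v
    using pair_no_loops[of "(v, v)"] in_arcsD1 by (auto simp: N_def)
  have bound: "card (N v) < card (pverts D)" if "v \<in> pverts D" for v
    using sub that pair_finite_verts by (intro psubset_card_mono) auto
  have mono: "card (N u) < card (N v)" if "(u, v) \<in> parcs D" for u v
  proof (rule psubset_card_mono)
    show "finite (N v)" using sub pair_finite_verts finite_subset by blast
    \<comment> \<open>Given w -> u -> v, the arc v -> w would close a triangle and w = v a 2-cycle,
      so totality leaves w -> v. Hence \<open>N u\<close> lies in \<open>N v\<close>, properly since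
      \<open>u\<close> is only in the latter.\<close>
    have "(w, v) \<in> parcs D" if "(w, u) \<in> parcs D" for w
      using acyclic_digraph_no_triangle[OF assms(1,2) that \<open>(u, v) \<in> parcs D\<close>]
        total[of w v] in_arcsD1[OF that] in_arcsD2[OF \<open>(u, v) \<in> parcs D\<close>]
        oriented[OF that] \<open>(u, v) \<in> parcs D\<close> by auto
    then show "N u \<subset> N v"
      using sub(2)[of u] that by (auto simp: N_def)
  qed
  have "(u, v) \<in> parcs D \<longleftrightarrow> card (N u) < card (N v)"
    if "u \<in> pverts D" "v \<in> pverts D" for u v
    using mono[of u v] mono[of v u] total[OF that] by (cases "u = v") auto
  with bound show thesis by (intro that[of "\<lambda>v. card (N v)"]) auto
qed

section \<open>Encoding tournaments\<close>

text \<open>The pairs in \<open>S\<close> are oriented upwards and all others downwards, so the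
  subsets of the pairs u < v index all tournaments on \<open>{..<n}\<close>.\<close>

definition tournament :: "nat \<Rightarrow> (nat \<times> nat) set \<Rightarrow> nat pair_pre_digraph" where
  "tournament n S = \<lparr>pverts = {..<n},
     parcs = {(u, v). u < n \<and> v < n \<and> (u < v \<and> (u, v) \<in> S \<or> v < u \<and> (v, u) \<notin> S)}\<rparr>"

lemma oriented_graph_tournament: "oriented_graph (tournament n S)"
proof
  show "finite (parcs (tournament n S))"
    by (rule finite_subset[of _ "{..<n} \<times> {..<n}"]) (auto simp: tournament_def)
qed (auto simp: tournament_def)

text \<open>The members of a code \<open>(f, I, G, c)\<close> are the ranks in the linear order, the index set of a
  spanning family, the Gram matrix of that family (its upper triangle, as the set of entries 1) and
  the coefficients of the other vectors.\<close>

definition codes :: "nat \<Rightarrow> nat \<Rightarrow>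
    ((nat \<Rightarrow> nat) \<times> nat set \<times> (nat \<times> nat) set \<times> (nat \<times> nat) set) set" where
  "codes n k = ({..<n} \<rightarrow>\<^sub>E {..<n}) \<times> (SIGMA I : {I. I \<subseteq> {..<n} \<and> card I = k}.
     Pow {(a, b). a \<in> I \<and> b \<in> I \<and> a \<le> b} \<times> Pow (({..<n} - I) \<times> I))"

text \<open>The double sum is the scalar product of two vectors expanded over \<open>I\<close>;
  \<open>min\<close> and \<open>max\<close> look up the symmetric Gram matrix in its upper triangle.
  The inequality of truth values undoes the inversions: the arc follows the order unless the product
  is 1.\<close>

definition decode :: "nat \<Rightarrow>
    (nat \<Rightarrow> nat) \<times> nat set \<times> (nat \<times> nat) set \<times> (nat \<times> nat) set \<Rightarrow> (nat \<times> nat) set" where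
  "decode n = (\<lambda>(f, I, G, c).
     let C = (\<lambda>j. if j \<in> I then {j} else c `` {j})
     in {(u, v). u < n \<and> v < n \<and> u < v \<and>
       (f u < f v) \<noteq> ((\<Sum>a\<in>C u. \<Sum>b\<in>C v. of_bool ((min a b, max a b) \<in> G) :: bit) = 1)})"

text \<open>The factors bound the choices of \<open>f\<close>, \<open>I\<close>, \<open>G\<close>
  and \<open>c\<close> in turn. The last two counts are the same for every \<open>I\<close> because
  its size is fixed.\<close>

lemma card_codes_le:
  assumes "k \<le> n"
  shows "finite (codes n k)"
    "card (codes n k) \<le> n ^ n * (2 ^ n * (2 ^ ((k * k + k) div 2) * 2 ^ ((n - k) * k)))"
proof -
  let ?S = "{I. I \<subseteq> {..<n} \<and> card I = k}"
  let ?G = "\<lambda>I :: nat set. {(a, b). a \<in> I \<and> b \<in> I \<and> a \<le> b}"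
  have finI: "finite I" if "I \<in> ?S" for I using that finite_subset[of I "{..<n}"] by auto
  have finG: "finite (?G I)" if "I \<in> ?S" for I
    by (rule finite_subset[of _ "I \<times> I"]) (use finI[OF that] in auto)
  have finS: "finite ?S" by (rule finite_subset[of _ "Pow {..<n}"]) auto
  have finP: "finite (Pow (?G I) \<times> Pow (({..<n} - I) \<times> I))" if "I \<in> ?S" for I
    using finG[OF that] finI[OF that] by (intro finite_cartesian_product) simp_all
  have "finite (SIGMA I : ?S. Pow (?G I) \<times> Pow (({..<n} - I) \<times> I))"
    by (rule finite_SigmaI[OF finS finP])
  moreover have "finite ({..<n} \<rightarrow>\<^sub>E {..<n})" by (simp add: finite_PiE)
  ultimately show "finite (codes n k)"
    unfolding codes_def by (rule finite_cartesian_product[rotated])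
  have card_P: "card (Pow (?G I) \<times> Pow (({..<n} - I) \<times> I)) =
      2 ^ ((k * k + k) div 2) * 2 ^ ((n - k) * k)" if "I \<in> ?S" for I
  proof -
    have "card (?G I) = (k * k + k) div 2"
      using card_le_pairs[OF finI[OF that]] that by auto
    moreover have "card (({..<n} - I) \<times> I) = (n - k) * k"
      using that finI[OF that] by (simp add: card_cartesian_product card_Diff_subset)
    ultimately show ?thesis
      using finG[OF that] finI[OF that] by (simp add: card_cartesian_product card_Pow)
  qed
  have "card (SIGMA I : ?S. Pow (?G I) \<times> Pow (({..<n} - I) \<times> I)) =
      (\<Sum>I\<in>?S. card (Pow (?G I) \<times> Pow (({..<n} - I) \<times> I)))"
    by (rule card_SigmaI[OF finS]) (rule ballI, rule finP)
  also have "\<dots> = (\<Sum>I\<in>?S. 2 ^ ((k * k + k) div 2) * 2 ^ ((n - k) * k))"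
    by (rule sum.cong[OF refl card_P])
  finally have "card (SIGMA I : ?S. Pow (?G I) \<times> Pow (({..<n} - I) \<times> I)) =
      card ?S * (2 ^ ((k * k + k) div 2) * 2 ^ ((n - k) * k))"
    by simp
  moreover have "card ?S \<le> 2 ^ n"
    using card_mono[of "Pow {..<n}" ?S] by (auto simp: card_Pow)
  ultimately show "card (codes n k) \<le>
      n ^ n * (2 ^ n * (2 ^ ((k * k + k) div 2) * 2 ^ ((n - k) * k)))"
    by (simp add: codes_def card_cartesian_product card_PiE)
qed

text \<open>The code comes from a decycling family of minimum size: the order is that of the
  resulting acyclic tournament, and of the family itself only scalar products are recorded.\<close>

lemma mem_decode_codes:
  assumes S: "S \<subseteq> {(u, v). u \<in> {..<n} \<and> v \<in> {..<n} \<and> u < v}"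
    and k: "inversion_number (tournament n S) \<le> k" "k \<le> n"
  shows "S \<in> decode n ` codes n k"
proof -
  let ?D = "tournament n S"
  obtain Xs where Xs: "decycling_family ?D Xs" "length Xs = inversion_number ?D"
    using inversion_number_attained[OF oriented_graph_tournament] by blast
  let ?E = "invert_family ?D Xs"
  have verts: "pverts ?E = {..<n}" by (simp add: tournament_def)
  have "(u, v) \<in> parcs ?E \<or> (v, u) \<in> parcs ?E" if "u < n" "v < n" "u \<noteq> v" for u v
    using that common_commute[of Xs u v] unfolding parcs_invert_family_iff
    by (auto simp: tournament_def)
  moreover have "acyclic_digraph ?E" using Xs(1) by (simp add: decycling_family_def)
  ultimately obtain f where f: "f \<in> {..<n} \<rightarrow> {..<n}"
      "\<And>u v. u < n \<Longrightarrow> v < n \<Longrightarrow> (u, v) \<in> parcs ?E \<longleftrightarrow> f u < f v"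
    using acyclic_tournament_rank[of ?E] oriented_graph_invert_family[OF oriented_graph_tournament]
    unfolding verts by (metis card_lessThan lessThan_iff)
  \<comment> \<open>The incidence vectors; only coordinates below \<open>length Xs\<close> are ever
    used.\<close>
  define x :: "nat \<Rightarrow> nat \<Rightarrow> bit" where "x = (\<lambda>i t. of_bool (i \<in> Xs ! t))"
  have common_x: "common Xs u v = (\<Sum>t<length Xs. x u t * x v t)" for u v
    unfolding common_def x_def sum_list_sum_nth length_map atLeast0LessThan
    by (rule sum.cong) (auto simp: of_bool_def)
  obtain I where I: "I \<subseteq> {..<n}" "card I = k"
    "\<And>j. j \<in> {..<n} \<Longrightarrow> \<exists>C\<subseteq>I. \<forall>t<length Xs. x j t = (\<Sum>i\<in>C. x i t)"
    using ex_spanning_subset[of "{..<n}" "length Xs" k x] k Xs(2) by auto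
  then obtain C where C: "\<And>j. j < n \<Longrightarrow> C j \<subseteq> I"
    "\<And>j t. j < n \<Longrightarrow> t < length Xs \<Longrightarrow> x j t = (\<Sum>i\<in>C j. x i t)"
    by (metis lessThan_iff)
  define G where "G = {(a, b). a \<in> I \<and> b \<in> I \<and> a \<le> b \<and> common Xs a b = 1}"
  define c where "c = {(j, i). j \<in> {..<n} - I \<and> i \<in> C j}"
  \<comment> \<open>\<open>I\<close> may be dependent, so for \<open>j\<close> in \<open>I\<close>
    the chosen \<open>C j\<close> need not be \<open>{j}\<close>. Since \<open>c\<close> stores
    coefficients only outside \<open>I\<close>, \<open>decode\<close> takes \<open>{j}\<close>
    there.\<close>
  define C' where "C' = (\<lambda>j. if j \<in> I then {j} else c `` {j})"
  have C': "C' j \<subseteq> I" "t < length Xs \<Longrightarrow> x j t = (\<Sum>i\<in>C' j. x i t)" if "j < n" for j t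
    using C[OF that] that by (auto simp: C'_def c_def)
  have G: "of_bool ((min a b, max a b) \<in> G) = common Xs a b" if "a \<in> I" "b \<in> I" for a b
    using that common_commute[of Xs a b]
    by (cases "common Xs a b") (auto simp: G_def min_def max_def)
  have gram: "common Xs u v = (\<Sum>a\<in>C' u. \<Sum>b\<in>C' v. of_bool ((min a b, max a b) \<in> G))"
    if "u < n" "v < n" for u v
  proof -
    \<comment> \<open>Expand both vectors over \<open>I\<close> and use bilinearity.\<close>
    have "common Xs u v = (\<Sum>t<length Xs. (\<Sum>a\<in>C' u. x a t) * (\<Sum>b\<in>C' v. x b t))"
      unfolding common_x using C'(2) that by (intro sum.cong) auto
    also have "\<dots> = (\<Sum>a\<in>C' u. \<Sum>b\<in>C' v. \<Sum>t<length Xs. x a t * x b t)"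
      unfolding sum_product
      by (rule trans[OF sum.swap]) (rule sum.cong[OF refl], rule sum.swap)
    also have "\<dots> = (\<Sum>a\<in>C' u. \<Sum>b\<in>C' v. of_bool ((min a b, max a b) \<in> G))"
      using C'(1) that G unfolding common_x[symmetric] by (intro sum.cong refl) (auto simp: subset_iff)
    finally show ?thesis .
  qed
  let ?code = "(restrict f {..<n}, I, G, c)"
  have decode: "decode n ?code = {(u, v). u < n \<and> v < n \<and> u < v \<and>
      (restrict f {..<n} u < restrict f {..<n} v) \<noteq>
      ((\<Sum>a\<in>C' u. \<Sum>b\<in>C' v. of_bool ((min a b, max a b) \<in> G)) = (1 :: bit))}"
    by (simp only: decode_def case_prod_conv Let_def C'_def)
  have "(u, v) \<in> S \<longleftrightarrow> (u, v) \<in> decode n ?code" for u v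
  proof (cases "u < n \<and> v < n \<and> u < v")
    case True
    then have "(u, v) \<in> S \<longleftrightarrow> (f u < f v) \<noteq> (common Xs u v = 1)"
      using f(2)[of u v] unfolding parcs_invert_family_iff
      by (auto simp: tournament_def split: if_splits)
    with True show ?thesis
      unfolding decode using gram[of u v] by simp
  next
    case False
    then show ?thesis using S unfolding decode by blast
  qed
  then have "S = decode n ?code" by auto
  moreover have "?code \<in> codes n k"
    using f(1) I(1,2) C(1) by (auto simp: codes_def G_def c_def)
  ultimately show ?thesis by blast
qed

section \<open>Counting and the final estimate\<close>

text \<open>Every tournament has inversion number at most \<open>k\<close> and hence a code, so
  there are at most as many tournaments as codes.\<close>

lemma max_inversion_number_counting:
  assumes "k = max_inversion_number n" "k \<le> n"
  shows "(2::nat) ^ ((n * n - n) div 2) \<le>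
    n ^ n * (2 ^ n * (2 ^ ((k * k + k) div 2) * 2 ^ ((n - k) * k)))"
proof -
  let ?E = "{(u, v). u \<in> {..<n} \<and> v \<in> {..<n} \<and> u < v}"
  have "finite ?E" by (rule finite_subset[of _ "{..<n} \<times> {..<n}"]) auto
  have "inversion_number (tournament n S) \<le> k" for S
    using inversion_number_le_max[OF oriented_graph_tournament[of n S]] assms(1)
    by (simp add: tournament_def)
  then have "Pow ?E \<subseteq> decode n ` codes n k"
    using mem_decode_codes assms(2) by blast
  then have "card (Pow ?E) \<le> card (codes n k)"
    by (rule surj_card_le[OF card_codes_le(1)[OF assms(2)]])
  moreover have "card ?E = (n * n - n) div 2"
    using card_less_pairs[of "{..<n}"] by auto
  ultimately show ?thesis
    using card_codes_le(2)[OF assms(2)] \<open>finite ?E\<close> by (simp add: card_Pow)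
qed

theorem theorem1p5:
  shows "\<exists>n\<^sub>0 :: nat. \<forall>n :: nat. n \<ge> n\<^sub>0 \<longrightarrow>
    real (max_inversion_number n) \<ge> real n - 2 * sqrt (real n * log 2 (real n))"
proof (intro exI[of _ 4] allI impI)
  fix n :: nat assume n: "4 \<le> n"
  define k where "k = max_inversion_number n"
  define L where "L = log 2 (real n)"
  \<comment> \<open>The threshold 4 makes \<open>L\<close> at least 2, so that \<open>n * L\<close>
    absorbs the linear terms at the end.\<close>
  have "log 2 4 \<le> L" unfolding L_def using n by (subst log_le_cancel_iff) auto
  moreover have "log 2 4 = (2 :: real)" using log_pow_cancel[of 2 2] by simp
  ultimately have L: "2 \<le> L" by simp
  have "real n - real k \<le> 2 * sqrt (real n * L)"
  proof (rule ccontr)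
    assume less: "\<not> ?thesis"
    define s where "s = real n - real k"
    have "0 \<le> real n * L" using L by simp
    then have "0 \<le> 2 * sqrt (real n * L)" by simp
    \<comment> \<open>The negated claim makes \<open>n - k\<close> exceed a nonnegative number,
      which gives the hypothesis of the counting bound.\<close>
    then have "k \<le> n" using less by linarith
    have "(2 * sqrt (real n * L))\<^sup>2 < s\<^sup>2"
      using less \<open>0 \<le> 2 * sqrt (real n * L)\<close> by (intro power_strict_mono) (auto simp: s_def)
    then have s: "4 * (real n * L) < s\<^sup>2"
      using \<open>0 \<le> real n * L\<close> by (simp add: power_mult_distrib)
    let ?a = "(n * n - n) div 2" and ?b = "(k * k + k) div 2"
    have "real (2 ^ ?a) \<le> real (n ^ n * (2 ^ n * (2 ^ ?b * 2 ^ ((n - k) * k))))"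
      using max_inversion_number_counting[OF k_def \<open>k \<le> n\<close>] by (simp only: of_nat_le_iff)
    then have "log 2 (2 ^ ?a) \<le> log 2 (real n ^ n * 2 ^ (n + ?b + (n - k) * k))"
      using n by (subst log_le_cancel_iff) (auto simp: power_add mult_ac)
    then have "real ?a \<le> real n * L + real (n + ?b + (n - k) * k)"
      using n by (simp add: log_mult log_nat_power L_def)
    then have "real ?a \<le> real n * L + real n + real ?b + s * real k"
      using \<open>k \<le> n\<close> by (simp add: of_nat_diff s_def)
    moreover have "real ?a = (real n * real n - real n) / 2"
      by (subst real_of_nat_div) (auto simp: of_nat_diff)
    moreover have "real ?b = (real k * real k + real k) / 2"
      by (subst real_of_nat_div) auto
    ultimately have "(real n * real n - real n) / 2 \<le>
        real n * L + real n + (real k * real k + real k) / 2 + s * real k"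
      by (simp only:)
    then have "real n * real n - real n \<le>
        2 * (real n * L) + 2 * real n + real k * real k + real k + 2 * (s * real k)"
      by (simp add: field_simps)
    \<comment> \<open>With n = k + s, the difference of n^2 and k^2 + 2sk is s^2.\<close>
    then have "s\<^sup>2 \<le> 2 * (real n * L) + 3 * real n + real k"
      by (simp add: s_def power2_eq_square algebra_simps)
    \<comment> \<open>As 3n + k \<le> 4n \<le> 2nL, this gives s^2 \<le> 4nL, against the
      assumption.\<close>
    moreover have "2 * real n \<le> real n * L" using mult_left_mono[OF L, of "real n"] by simp
    ultimately show False using s \<open>k \<le> n\<close> by linarith
  qed
  then show "real n - 2 * sqrt (real n * log 2 (real n)) \<le> real (max_inversion_number n)"
    by (simp add: L_def k_def)
qed

end
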